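(* Let $k$ be a commutative ring with identity, $A$ a pre-Lie $k$-algebra, and $I,J$ two ideals of $A$. The Huq commutator $[I,J]_H$ of $I$ and $J$ is the ideal of $A$ generated by the subset $\{\,ij,\ ji\mid i\in I,\ j\in J\,\}$.
   Context: A $k$-algebra is a $k$-module with a $k$-bilinear multiplication (not necessarily associative). A pre-Lie $k$-algebra is a $k$-algebra $A$ with $(xy)z-x(yz)=(yx)z-y(xz)$ for all $x,y,z\in A$. Pre-Lie algebra morphisms are $k$-linear multiplicative mappings. An ideal of $A$ is a $k$-submodule $N$ with $xn\in N$ and $nx\in N$ for all $x\in A$, $n\in N$; the ideal generated by a subset is the intersection of all ideals containing it. The Huq commutator $[I,J]_H$ is the smallest ideal $K$ of $A$ for which the mapping $I\times J\to A/K$, $(i,j)\mapsto i+j+K$, is a pre-Lie algebra morphism ($I\times J$ with componentwise operations). *)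

theory Defs
  imports "HOL-Algebra.Algebra"
begin

text \<open>
  Algebras over \<open>R\<close> are encoded by the record type of modules of the library, whose \<open>mult\<close> field
  carries the (neither associative nor unital) multiplication. The \<open>one\<close> field of that record is
  never constrained and plays no role.
\<close>

locale nonassoc_algebra = module R A for R (structure) and A (structure) +
  assumes mult_closed:
      "\<lbrakk>x \<in> carrier A; y \<in> carrier A\<rbrakk> \<Longrightarrow> x \<otimes>\<^bsub>A\<^esub> y \<in> carrier A"
    and mult_add_left:
      "\<lbrakk>x \<in> carrier A; y \<in> carrier A; z \<in> carrier A\<rbrakk> \<Longrightarrow>
        (x \<oplus>\<^bsub>A\<^esub> y) \<otimes>\<^bsub>A\<^esub> z = x \<otimes>\<^bsub>A\<^esub> z \<oplus>\<^bsub>A\<^esub> y \<otimes>\<^bsub>A\<^esub> z"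
    and mult_add_right:
      "\<lbrakk>x \<in> carrier A; y \<in> carrier A; z \<in> carrier A\<rbrakk> \<Longrightarrow>
        x \<otimes>\<^bsub>A\<^esub> (y \<oplus>\<^bsub>A\<^esub> z) = x \<otimes>\<^bsub>A\<^esub> y \<oplus>\<^bsub>A\<^esub> x \<otimes>\<^bsub>A\<^esub> z"
    and mult_smult_left:
      "\<lbrakk>a \<in> carrier R; x \<in> carrier A; y \<in> carrier A\<rbrakk> \<Longrightarrow>
        (a \<odot>\<^bsub>A\<^esub> x) \<otimes>\<^bsub>A\<^esub> y = a \<odot>\<^bsub>A\<^esub> (x \<otimes>\<^bsub>A\<^esub> y)"
    and mult_smult_right:
      "\<lbrakk>a \<in> carrier R; x \<in> carrier A; y \<in> carrier A\<rbrakk> \<Longrightarrow>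
        x \<otimes>\<^bsub>A\<^esub> (a \<odot>\<^bsub>A\<^esub> y) = a \<odot>\<^bsub>A\<^esub> (x \<otimes>\<^bsub>A\<^esub> y)"

locale prelie_algebra = nonassoc_algebra R A for R (structure) and A (structure) +
  assumes prelie:
      "\<lbrakk>x \<in> carrier A; y \<in> carrier A; z \<in> carrier A\<rbrakk> \<Longrightarrow>
        (x \<otimes>\<^bsub>A\<^esub> y) \<otimes>\<^bsub>A\<^esub> z \<ominus>\<^bsub>A\<^esub> x \<otimes>\<^bsub>A\<^esub> (y \<otimes>\<^bsub>A\<^esub> z) =
        (y \<otimes>\<^bsub>A\<^esub> x) \<otimes>\<^bsub>A\<^esub> z \<ominus>\<^bsub>A\<^esub> y \<otimes>\<^bsub>A\<^esub> (x \<otimes>\<^bsub>A\<^esub> z)"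

definition prelie_hom ::
  "('k, 'r) ring_scheme \<Rightarrow> ('k, 'a, 'm) module_scheme \<Rightarrow> ('k, 'b, 'n) module_scheme \<Rightarrow> ('a \<Rightarrow> 'b) set"
  where "prelie_hom R A B = {h. h \<in> carrier A \<rightarrow> carrier B \<and>
    (\<forall>x \<in> carrier A. \<forall>y \<in> carrier A. h (x \<oplus>\<^bsub>A\<^esub> y) = h x \<oplus>\<^bsub>B\<^esub> h y) \<and>
    (\<forall>a \<in> carrier R. \<forall>x \<in> carrier A. h (a \<odot>\<^bsub>A\<^esub> x) = a \<odot>\<^bsub>B\<^esub> h x) \<and>
    (\<forall>x \<in> carrier A. \<forall>y \<in> carrier A. h (x \<otimes>\<^bsub>A\<^esub> y) = h x \<otimes>\<^bsub>B\<^esub> h y)}"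

definition algebra_ideal ::
  "('k, 'r) ring_scheme \<Rightarrow> ('k, 'a, 'm) module_scheme \<Rightarrow> 'a set \<Rightarrow> bool"
  where "algebra_ideal R A N \<longleftrightarrow> submodule N R A \<and>
    (\<forall>x \<in> carrier A. \<forall>n \<in> N. x \<otimes>\<^bsub>A\<^esub> n \<in> N \<and> n \<otimes>\<^bsub>A\<^esub> x \<in> N)"

definition ideal_generated ::
  "('k, 'r) ring_scheme \<Rightarrow> ('k, 'a, 'm) module_scheme \<Rightarrow> 'a set \<Rightarrow> 'a set"
  where "ideal_generated R A S = \<Inter>{N. algebra_ideal R A N \<and> S \<subseteq> N}"

definition algebra_prod ::
  "('k, 'a, 'm) module_scheme \<Rightarrow> ('k, 'b, 'n) module_scheme \<Rightarrow> ('k, 'a \<times> 'b) module"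
  where "algebra_prod A B = ring.extend (RDirProd A B)
    \<lparr>smult = (\<lambda>a (x, y). (a \<odot>\<^bsub>A\<^esub> x, a \<odot>\<^bsub>B\<^esub> y))\<rparr>"

text \<open>
  Scalar multiplication of cosets follows the style of \<^const>\<open>rcoset_mult\<close>: the union runs over
  all representatives, and \<open>a \<odot> (K +> x) = K +> (a \<odot> x)\<close> when \<open>K\<close> is a submodule.
\<close>

definition algebra_quot ::
  "('k, 'a, 'm) module_scheme \<Rightarrow> 'a set \<Rightarrow> ('k, 'a set) module"
  where "algebra_quot A K = ring.extend (A Quot K)
    \<lparr>smult = (\<lambda>a C. \<Union>x\<in>C. K +>\<^bsub>A\<^esub> (a \<odot>\<^bsub>A\<^esub> x))\<rparr>"

definition huq_admissible ::
  "('k, 'r) ring_scheme \<Rightarrow> ('k, 'a, 'm) module_scheme \<Rightarrow> 'a set \<Rightarrow> 'a set \<Rightarrow> 'a set \<Rightarrow> bool"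
  where "huq_admissible R A I J K \<longleftrightarrow> algebra_ideal R A K \<and>
    (\<lambda>(i, j). K +>\<^bsub>A\<^esub> (i \<oplus>\<^bsub>A\<^esub> j)) \<in>
      prelie_hom R (algebra_prod (A\<lparr>carrier := I\<rparr>) (A\<lparr>carrier := J\<rparr>)) (algebra_quot A K)"

definition is_huq_commutator ::
  "('k, 'r) ring_scheme \<Rightarrow> ('k, 'a, 'm) module_scheme \<Rightarrow> 'a set \<Rightarrow> 'a set \<Rightarrow> 'a set \<Rightarrow> bool"
  where "is_huq_commutator R A I J K \<longleftrightarrow> huq_admissible R A I J K \<and>
    (\<forall>K'. huq_admissible R A I J K' \<longrightarrow> K \<subseteq> K')"

lemma algebra_prod_simps [simp]:
  "carrier (algebra_prod A B) = carrier A \<times> carrier B"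
  "(x, y) \<oplus>\<^bsub>algebra_prod A B\<^esub> (x', y') = (x \<oplus>\<^bsub>A\<^esub> x', y \<oplus>\<^bsub>B\<^esub> y')"
  "(x, y) \<otimes>\<^bsub>algebra_prod A B\<^esub> (x', y') = (x \<otimes>\<^bsub>A\<^esub> x', y \<otimes>\<^bsub>B\<^esub> y')"
  "a \<odot>\<^bsub>algebra_prod A B\<^esub> (x, y) = (a \<odot>\<^bsub>A\<^esub> x, a \<odot>\<^bsub>B\<^esub> y)"
  "\<zero>\<^bsub>algebra_prod A B\<^esub> = (\<zero>\<^bsub>A\<^esub>, \<zero>\<^bsub>B\<^esub>)"
  by (simp_all add: algebra_prod_def RDirProd_def DirProd_def monoid.defs ring.defs)

lemma algebra_quot_simps:
  "carrier (algebra_quot A K) = a_rcosets\<^bsub>A\<^esub> K"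
  "C \<oplus>\<^bsub>algebra_quot A K\<^esub> D = C <+>\<^bsub>A\<^esub> D"
  "C \<otimes>\<^bsub>algebra_quot A K\<^esub> D = rcoset_mult A K C D"
  "a \<odot>\<^bsub>algebra_quot A K\<^esub> C = (\<Union>x\<in>C. K +>\<^bsub>A\<^esub> (a \<odot>\<^bsub>A\<^esub> x))"
  "\<zero>\<^bsub>algebra_quot A K\<^esub> = K"
  by (simp_all add: algebra_quot_def FactRing_def ring.defs)

lemma prelie_algebraI':
  assumes "module R A"
    and "\<And>x y. \<lbrakk>x \<in> carrier A; y \<in> carrier A\<rbrakk> \<Longrightarrow> x \<otimes>\<^bsub>A\<^esub> y \<in> carrier A"
    and "\<And>x y z. \<lbrakk>x \<in> carrier A; y \<in> carrier A; z \<in> carrier A\<rbrakk> \<Longrightarrow>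
        (x \<oplus>\<^bsub>A\<^esub> y) \<otimes>\<^bsub>A\<^esub> z = x \<otimes>\<^bsub>A\<^esub> z \<oplus>\<^bsub>A\<^esub> y \<otimes>\<^bsub>A\<^esub> z"
    and "\<And>x y z. \<lbrakk>x \<in> carrier A; y \<in> carrier A; z \<in> carrier A\<rbrakk> \<Longrightarrow>
        x \<otimes>\<^bsub>A\<^esub> (y \<oplus>\<^bsub>A\<^esub> z) = x \<otimes>\<^bsub>A\<^esub> y \<oplus>\<^bsub>A\<^esub> x \<otimes>\<^bsub>A\<^esub> z"
    and "\<And>a x y. \<lbrakk>a \<in> carrier R; x \<in> carrier A; y \<in> carrier A\<rbrakk> \<Longrightarrow>
        (a \<odot>\<^bsub>A\<^esub> x) \<otimes>\<^bsub>A\<^esub> y = a \<odot>\<^bsub>A\<^esub> (x \<otimes>\<^bsub>A\<^esub> y)"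
    and "\<And>a x y. \<lbrakk>a \<in> carrier R; x \<in> carrier A; y \<in> carrier A\<rbrakk> \<Longrightarrow>
        x \<otimes>\<^bsub>A\<^esub> (a \<odot>\<^bsub>A\<^esub> y) = a \<odot>\<^bsub>A\<^esub> (x \<otimes>\<^bsub>A\<^esub> y)"
    and pl: "\<And>x y z. \<lbrakk>x \<in> carrier A; y \<in> carrier A; z \<in> carrier A\<rbrakk> \<Longrightarrow>
        (x \<otimes>\<^bsub>A\<^esub> y) \<otimes>\<^bsub>A\<^esub> z \<oplus>\<^bsub>A\<^esub> y \<otimes>\<^bsub>A\<^esub> (x \<otimes>\<^bsub>A\<^esub> z) =
        (y \<otimes>\<^bsub>A\<^esub> x) \<otimes>\<^bsub>A\<^esub> z \<oplus>\<^bsub>A\<^esub> x \<otimes>\<^bsub>A\<^esub> (y \<otimes>\<^bsub>A\<^esub> z)"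
  shows "prelie_algebra R A"
proof -
  interpret module R A by fact
  have aux: "p \<ominus>\<^bsub>A\<^esub> q = r \<ominus>\<^bsub>A\<^esub> s"
    if "p \<in> carrier A" "q \<in> carrier A" "r \<in> carrier A" "s \<in> carrier A" "p \<oplus>\<^bsub>A\<^esub> s = r \<oplus>\<^bsub>A\<^esub> q"
    for p q r s
  proof -
    have "p \<ominus>\<^bsub>A\<^esub> q = (p \<oplus>\<^bsub>A\<^esub> s) \<oplus>\<^bsub>A\<^esub> (\<ominus>\<^bsub>A\<^esub> s \<oplus>\<^bsub>A\<^esub> \<ominus>\<^bsub>A\<^esub> q)"
      using that(1-4) by (simp add: M.a_assoc a_minus_def M.r_neg1 M.r_neg2)
    also have "\<dots> = (r \<oplus>\<^bsub>A\<^esub> q) \<oplus>\<^bsub>A\<^esub> (\<ominus>\<^bsub>A\<^esub> s \<oplus>\<^bsub>A\<^esub> \<ominus>\<^bsub>A\<^esub> q)" by (simp add: that(5))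
    also have "\<dots> = r \<ominus>\<^bsub>A\<^esub> s"
      using that(1-4) by (simp add: M.a_assoc M.a_comm[of "\<ominus>\<^bsub>A\<^esub> s"] a_minus_def M.r_neg1 M.r_neg2)
    finally show ?thesis .
  qed
  show ?thesis
    by unfold_locales (use assms in \<open>auto intro!: aux\<close>)
qed

lemma (in prelie_algebra) prelie':
  assumes "x \<in> carrier A" "y \<in> carrier A" "z \<in> carrier A"
  shows "(x \<otimes>\<^bsub>A\<^esub> y) \<otimes>\<^bsub>A\<^esub> z \<oplus>\<^bsub>A\<^esub> y \<otimes>\<^bsub>A\<^esub> (x \<otimes>\<^bsub>A\<^esub> z) =
         (y \<otimes>\<^bsub>A\<^esub> x) \<otimes>\<^bsub>A\<^esub> z \<oplus>\<^bsub>A\<^esub> x \<otimes>\<^bsub>A\<^esub> (y \<otimes>\<^bsub>A\<^esub> z)"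
proof -
  have aux: "p \<oplus>\<^bsub>A\<^esub> s = r \<oplus>\<^bsub>A\<^esub> q"
    if "p \<in> carrier A" "q \<in> carrier A" "r \<in> carrier A" "s \<in> carrier A" "p \<ominus>\<^bsub>A\<^esub> q = r \<ominus>\<^bsub>A\<^esub> s"
    for p q r s
  proof -
    have "p \<oplus>\<^bsub>A\<^esub> s = (p \<ominus>\<^bsub>A\<^esub> q) \<oplus>\<^bsub>A\<^esub> (q \<oplus>\<^bsub>A\<^esub> s)"
      using that(1-4) by (simp add: M.a_assoc a_minus_def M.r_neg1 M.r_neg2)
    also have "\<dots> = (r \<ominus>\<^bsub>A\<^esub> s) \<oplus>\<^bsub>A\<^esub> (s \<oplus>\<^bsub>A\<^esub> q)" using that by (simp add: M.a_comm)
    also have "\<dots> = r \<oplus>\<^bsub>A\<^esub> q"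
      using that(1-4) by (simp add: M.a_assoc a_minus_def M.r_neg1 M.r_neg2)
    finally show ?thesis .
  qed
  show ?thesis by (intro aux) (use assms mult_closed prelie in auto)
qed

lemma (in prelie_algebra) ideal_prelie_algebra:
  assumes "algebra_ideal R A I"
  shows "prelie_algebra R (A\<lparr>carrier := I\<rparr>)"
proof -
  have sub: "submodule I R A" and cl: "\<And>x n. \<lbrakk>x \<in> carrier A; n \<in> I\<rbrakk> \<Longrightarrow> x \<otimes>\<^bsub>A\<^esub> n \<in> I"
    using assms by (auto simp: algebra_ideal_def)
  have "I \<subseteq> carrier A" using submoduleE(1)[OF sub] .
  then show ?thesis
    by (intro prelie_algebraI' submodule.submodule_is_module[OF sub] module_axioms)
      (auto intro!: cl mult_add_left mult_add_right mult_smult_left mult_smult_right prelie' simp: subset_iff)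
qed

lemma algebra_prod_prelie_algebra:
  assumes "prelie_algebra R A" "prelie_algebra R B"
  shows "prelie_algebra R (algebra_prod A B)"
proof -
  interpret A: prelie_algebra R A by fact
  interpret B: prelie_algebra R B by fact
  have "module R (algebra_prod A B)"
  proof (rule moduleI)
    show "abelian_group (algebra_prod A B)"
    proof (rule abelian_groupI)
      fix x assume "x \<in> carrier (algebra_prod A B)"
      then show "\<exists>y\<in>carrier (algebra_prod A B). y \<oplus>\<^bsub>algebra_prod A B\<^esub> x = \<zero>\<^bsub>algebra_prod A B\<^esub>"
        by (cases x) (auto intro!: bexI[of _ "(\<ominus>\<^bsub>A\<^esub> fst x, \<ominus>\<^bsub>B\<^esub> snd x)"] simp: A.M.l_neg B.M.l_neg)
    qed (auto simp: A.M.a_ac B.M.a_ac)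
  qed (auto simp: A.R.cring_axioms A.smult_l_distr B.smult_l_distr A.smult_r_distr B.smult_r_distr
        A.smult_assoc1 B.smult_assoc1)
  then show ?thesis
    by (rule prelie_algebraI')
      (auto simp: A.mult_closed B.mult_closed A.mult_add_left B.mult_add_left A.mult_add_right
        B.mult_add_right A.mult_smult_left B.mult_smult_left A.mult_smult_right B.mult_smult_right
        A.prelie' B.prelie')
qed

context prelie_algebra
begin

lemma algebra_ideal_abelian_subgroup:
  assumes "algebra_ideal R A K"
  shows "abelian_subgroup K A"
proof -
  have "subgroup K (add_monoid A)"
    using assms by (auto simp: algebra_ideal_def submodule_def)
  then show ?thesis
    by (intro abelian_subgroupI3 additive_subgroupI M.abelian_group_axioms)
qed

lemma
  assumes K: "algebra_ideal R A K" and x: "x \<in> carrier A"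
  shows algebra_quot_add: "y \<in> carrier A \<Longrightarrow>
      (K +>\<^bsub>A\<^esub> x) \<oplus>\<^bsub>algebra_quot A K\<^esub> (K +>\<^bsub>A\<^esub> y) = K +>\<^bsub>A\<^esub> (x \<oplus>\<^bsub>A\<^esub> y)"
    and algebra_quot_mult: "y \<in> carrier A \<Longrightarrow>
      (K +>\<^bsub>A\<^esub> x) \<otimes>\<^bsub>algebra_quot A K\<^esub> (K +>\<^bsub>A\<^esub> y) = K +>\<^bsub>A\<^esub> (x \<otimes>\<^bsub>A\<^esub> y)"
    and algebra_quot_smult: "a \<in> carrier R \<Longrightarrow>
      a \<odot>\<^bsub>algebra_quot A K\<^esub> (K +>\<^bsub>A\<^esub> x) = K +>\<^bsub>A\<^esub> (a \<odot>\<^bsub>A\<^esub> x)"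
proof -
  interpret K: abelian_subgroup K A by (rule algebra_ideal_abelian_subgroup[OF K])
  have K': "submodule K R A"
      "\<And>x n. \<lbrakk>x \<in> carrier A; n \<in> K\<rbrakk> \<Longrightarrow> x \<otimes>\<^bsub>A\<^esub> n \<in> K"
      "\<And>x n. \<lbrakk>x \<in> carrier A; n \<in> K\<rbrakk> \<Longrightarrow> n \<otimes>\<^bsub>A\<^esub> x \<in> K"
    using K by (auto simp: algebra_ideal_def)
  have rep: "K +>\<^bsub>A\<^esub> (k \<oplus>\<^bsub>A\<^esub> z) = K +>\<^bsub>A\<^esub> z" if "k \<in> K" "z \<in> carrier A" for k z
    using that by (intro K.a_repr_independence'[symmetric] M.a_rcosI K.a_subset)
  have mem: "\<exists>k\<in>K. z = k \<oplus>\<^bsub>A\<^esub> x" if "z \<in> K +>\<^bsub>A\<^esub> x" for z x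
    using that by (auto simp: a_r_coset_def')
  show "(K +>\<^bsub>A\<^esub> x) \<oplus>\<^bsub>algebra_quot A K\<^esub> (K +>\<^bsub>A\<^esub> y) = K +>\<^bsub>A\<^esub> (x \<oplus>\<^bsub>A\<^esub> y)"
    if "y \<in> carrier A"
    using x that by (simp add: algebra_quot_simps K.a_rcos_sum)
  show "a \<odot>\<^bsub>algebra_quot A K\<^esub> (K +>\<^bsub>A\<^esub> x) = K +>\<^bsub>A\<^esub> (a \<odot>\<^bsub>A\<^esub> x)" if a: "a \<in> carrier R"
  proof -
    have "K +>\<^bsub>A\<^esub> (a \<odot>\<^bsub>A\<^esub> z) = K +>\<^bsub>A\<^esub> (a \<odot>\<^bsub>A\<^esub> x)" if z: "z \<in> K +>\<^bsub>A\<^esub> x" for z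
    proof -
      obtain k where k: "k \<in> K" "z = k \<oplus>\<^bsub>A\<^esub> x" using mem[OF z] by blast
      then have "a \<odot>\<^bsub>A\<^esub> z = a \<odot>\<^bsub>A\<^esub> k \<oplus>\<^bsub>A\<^esub> a \<odot>\<^bsub>A\<^esub> x"
        using a x K.a_subset by (auto intro: smult_r_distr)
      then show ?thesis using rep[OF submodule.smult_closed[OF K'(1) a k(1)]] a x by simp
    qed
    moreover have "x \<in> K +>\<^bsub>A\<^esub> x" using x by (rule K.a_rcos_self)
    ultimately show ?thesis unfolding algebra_quot_simps by blast
  qed
  show "(K +>\<^bsub>A\<^esub> x) \<otimes>\<^bsub>algebra_quot A K\<^esub> (K +>\<^bsub>A\<^esub> y) = K +>\<^bsub>A\<^esub> (x \<otimes>\<^bsub>A\<^esub> y)"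
    if y: "y \<in> carrier A"
  proof -
    have "K +>\<^bsub>A\<^esub> (z \<otimes>\<^bsub>A\<^esub> w) = K +>\<^bsub>A\<^esub> (x \<otimes>\<^bsub>A\<^esub> y)"
      if zw: "z \<in> K +>\<^bsub>A\<^esub> x" "w \<in> K +>\<^bsub>A\<^esub> y" for z w
    proof -
      obtain k where k: "k \<in> K" "z = k \<oplus>\<^bsub>A\<^esub> x" using mem[OF zw(1)] by blast
      obtain l where l: "l \<in> K" "w = l \<oplus>\<^bsub>A\<^esub> y" using mem[OF zw(2)] by blast
      have kl: "k \<in> carrier A" "l \<in> carrier A" using k l K.a_subset by auto
      then have w: "w \<in> carrier A" using l y by auto
      have "z \<otimes>\<^bsub>A\<^esub> w = k \<otimes>\<^bsub>A\<^esub> w \<oplus>\<^bsub>A\<^esub> (x \<otimes>\<^bsub>A\<^esub> l \<oplus>\<^bsub>A\<^esub> x \<otimes>\<^bsub>A\<^esub> y)"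
        using k(2) l(2) kl w x y by (simp add: mult_add_left mult_add_right mult_closed M.a_ac)
      then show ?thesis
        using rep[OF K'(3)[OF w k(1)]] rep[OF K'(2)[OF x l(1)]] x y kl by (simp add: mult_closed)
    qed
    moreover have "x \<in> K +>\<^bsub>A\<^esub> x" "y \<in> K +>\<^bsub>A\<^esub> y" using x y by (auto intro: K.a_rcos_self)
    ultimately show ?thesis unfolding algebra_quot_simps rcoset_mult_def by blast
  qed
qed

lemma algebra_quot_prelie_algebra:
  assumes K: "algebra_ideal R A K"
  shows "prelie_algebra R (algebra_quot A K)"
proof -
  interpret K: abelian_subgroup K A by (rule algebra_ideal_abelian_subgroup[OF K])
  note q = algebra_quot_add[OF K] algebra_quot_mult[OF K] algebra_quot_smult[OF K]
  have car: "carrier (algebra_quot A K) = (\<lambda>x. K +>\<^bsub>A\<^esub> x) ` carrier A"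
    by (auto simp: algebra_quot_simps A_RCOSETS_def')
  have zero: "\<zero>\<^bsub>algebra_quot A K\<^esub> = K +>\<^bsub>A\<^esub> \<zero>\<^bsub>A\<^esub>"
    by (simp add: algebra_quot_simps K.a_subset)
  have "abelian_group (algebra_quot A K)"
  proof (rule abelian_groupI)
    fix C assume "C \<in> carrier (algebra_quot A K)"
    then obtain x where x: "x \<in> carrier A" "C = K +>\<^bsub>A\<^esub> x" by (auto simp: car)
    then show "\<exists>D\<in>carrier (algebra_quot A K).
        D \<oplus>\<^bsub>algebra_quot A K\<^esub> C = \<zero>\<^bsub>algebra_quot A K\<^esub>"
      by (intro bexI[of _ "K +>\<^bsub>A\<^esub> (\<ominus>\<^bsub>A\<^esub> x)"]) (simp_all add: car q zero M.l_neg)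
  qed (auto simp: car q zero M.a_ac simp del: M.a_coset_add_zero)
  then have "module R (algebra_quot A K)"
    by (intro moduleI R.cring_axioms)
      (auto simp: car q smult_l_distr smult_r_distr smult_assoc1)
  then show ?thesis
    by (rule prelie_algebraI')
      (auto simp: car q mult_closed mult_add_left mult_add_right mult_smult_left mult_smult_right
        prelie')
qed

end

end

theory Submission
  imports Defs
begin

text \<open>
  Expanding \<open>(i + j)(i' + j') = (ii' + jj') + (ij' + ji')\<close> shows that \<open>(i, j) \<mapsto> i + j + K\<close> is
  multiplicative as soon as \<open>K\<close> contains all \<open>ij\<close> and \<open>ji\<close>; evaluating multiplicativity on
  \<open>(i, 0)(0, j)\<close> and \<open>(0, j)(i, 0)\<close> gives the converse. Additivity and compatibility with scalars
  hold for every ideal \<open>K\<close>.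
\<close>

context nonassoc_algebra
begin

text \<open>Zero is rewritten as the scalar multiple of itself by \<open>\<zero>\<close>; pulled out
  of the product, this scalar annihilates it.\<close>

lemma mult_zero_left:
  assumes "x \<in> carrier A"
  shows "\<zero>\<^bsub>A\<^esub> \<otimes>\<^bsub>A\<^esub> x = \<zero>\<^bsub>A\<^esub>"
  using mult_smult_left[of \<zero> "\<zero>\<^bsub>A\<^esub>" x] assms mult_closed[of "\<zero>\<^bsub>A\<^esub>" x] smult_l_null by simp

lemma algebra_ideal_carrier: "algebra_ideal R A (carrier A)"
  by (simp add: algebra_ideal_def carrier_is_submodule mult_closed)

text \<open>The empty family is excluded because its intersection is the whole type, which need not
  lie inside \<open>carrier A\<close>.\<close>

lemma algebra_ideal_Inter:
  assumes "\<N> \<noteq> {}" and ideals: "\<And>N. N \<in> \<N> \<Longrightarrow> algebra_ideal R A N"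
  shows "algebra_ideal R A (\<Inter>\<N>)"
proof -
  have sub: "submodule N R A" if "N \<in> \<N>" for N
    using ideals[OF that] by (simp add: algebra_ideal_def)
  have "submodule (\<Inter>\<N>) R A"
  proof (intro submoduleI)
    show "\<Inter>\<N> \<subseteq> carrier A"
      using \<open>\<N> \<noteq> {}\<close> submoduleE(1)[OF sub] by blast
    show "\<zero>\<^bsub>A\<^esub> \<in> \<Inter>\<N>"
      \<comment> \<open>A submodule is a subgroup of \<open>add_monoid A\<close>, whose unit is the
        zero of \<open>A\<close>.\<close>
      using subgroup.one_closed[OF submodule.axioms(1)[OF sub]] by simp
  qed (use submoduleE(3-5)[OF sub] in blast)+
  then show ?thesis
    using ideals by (simp add: algebra_ideal_def)
qed

lemma algebra_ideal_ideal_generated: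
  assumes "S \<subseteq> carrier A"
  shows "algebra_ideal R A (ideal_generated R A S)"
  unfolding ideal_generated_def
  \<comment> \<open>The carrier is itself an ideal containing \<open>S\<close>, so the intersected
    family is nonempty.\<close>
  using assms algebra_ideal_carrier by (intro algebra_ideal_Inter) auto

end

lemma ideal_generated_superset: "S \<subseteq> ideal_generated R A S"
  by (auto simp: ideal_generated_def)

lemma ideal_generated_least:
  assumes "algebra_ideal R A N" and "S \<subseteq> N"
  shows "ideal_generated R A S \<subseteq> N"
  using assms by (auto simp: ideal_generated_def)

context prelie_algebra
begin

text \<open>Here \<open>x\<close> will be the sum of the componentwise products and \<open>y\<close>
  the sum of the cross terms, so multiplicativity becomes a membership statement about
  \<open>K\<close>.\<close>

lemma coset_eq_add_iff:
  assumes K: "algebra_ideal R A K" and "x \<in> carrier A" "y \<in> carrier A"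
  shows "K +>\<^bsub>A\<^esub> x = K +>\<^bsub>A\<^esub> (x \<oplus>\<^bsub>A\<^esub> y) \<longleftrightarrow> y \<in> K"
proof -
  interpret K: abelian_subgroup K A by (rule algebra_ideal_abelian_subgroup[OF K])
  show ?thesis
  proof
    assume "K +>\<^bsub>A\<^esub> x = K +>\<^bsub>A\<^esub> (x \<oplus>\<^bsub>A\<^esub> y)"
    then have "x \<oplus>\<^bsub>A\<^esub> y \<in> K +>\<^bsub>A\<^esub> x"
      using assms K.a_rcos_self by simp
    then obtain k where "k \<in> K" "x \<oplus>\<^bsub>A\<^esub> y = k \<oplus>\<^bsub>A\<^esub> x"
      by (auto simp: a_r_coset_def')
    moreover from this have "k \<in> carrier A"
      using K.a_subset by blast
    ultimately show "y \<in> K"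
      using assms by (metis M.a_comm M.add.l_cancel)
  next
    assume "y \<in> K"
    then have "x \<oplus>\<^bsub>A\<^esub> y \<in> K +>\<^bsub>A\<^esub> x"
      using assms M.a_rcosI[of y K x] K.a_subset by (simp add: M.a_comm)
    then show "K +>\<^bsub>A\<^esub> x = K +>\<^bsub>A\<^esub> (x \<oplus>\<^bsub>A\<^esub> y)"
      using assms by (intro K.a_repr_independence')
  qed
qed

lemma huq_admissible_iff:
  assumes I: "algebra_ideal R A I" and J: "algebra_ideal R A J"
  shows "huq_admissible R A I J K \<longleftrightarrow> algebra_ideal R A K \<and>
    (\<forall>i\<in>I. \<forall>j\<in>J. i \<otimes>\<^bsub>A\<^esub> j \<in> K \<and> j \<otimes>\<^bsub>A\<^esub> i \<in> K)"
\<comment> \<open>Both sides contain this conjunct; once it holds, the operations of the quotient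
  can be computed on representatives.\<close>
proof (cases "algebra_ideal R A K")
  case False
  then show ?thesis by (simp add: huq_admissible_def)
next
  case K: True
  interpret I: abelian_subgroup I A by (rule algebra_ideal_abelian_subgroup[OF I])
  interpret J: abelian_subgroup J A by (rule algebra_ideal_abelian_subgroup[OF J])
  interpret K: abelian_subgroup K A by (rule algebra_ideal_abelian_subgroup[OF K])
  have IA: "i \<in> carrier A" if "i \<in> I" for i using that I.a_subset by blast
  have JA: "j \<in> carrier A" if "j \<in> J" for j using that J.a_subset by blast
  note q = algebra_quot_add[OF K] algebra_quot_mult[OF K] algebra_quot_smult[OF K]
  have maps: "K +>\<^bsub>A\<^esub> (i \<oplus>\<^bsub>A\<^esub> j) \<in> carrier (algebra_quot A K)" if "i \<in> I" "j \<in> J" for i j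
    using that IA JA by (auto simp: algebra_quot_simps A_RCOSETS_def')
  have add: "K +>\<^bsub>A\<^esub> (i \<oplus>\<^bsub>A\<^esub> i' \<oplus>\<^bsub>A\<^esub> (j \<oplus>\<^bsub>A\<^esub> j')) =
      (K +>\<^bsub>A\<^esub> (i \<oplus>\<^bsub>A\<^esub> j)) \<oplus>\<^bsub>algebra_quot A K\<^esub> (K +>\<^bsub>A\<^esub> (i' \<oplus>\<^bsub>A\<^esub> j'))"
    if "i \<in> I" "j \<in> J" "i' \<in> I" "j' \<in> J" for i j i' j'
    using that IA JA by (simp add: q M.a_ac)
  have smult: "K +>\<^bsub>A\<^esub> (a \<odot>\<^bsub>A\<^esub> i \<oplus>\<^bsub>A\<^esub> a \<odot>\<^bsub>A\<^esub> j) =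
      a \<odot>\<^bsub>algebra_quot A K\<^esub> (K +>\<^bsub>A\<^esub> (i \<oplus>\<^bsub>A\<^esub> j))"
    if "a \<in> carrier R" "i \<in> I" "j \<in> J" for a i j
    using that IA JA by (simp add: q smult_r_distr)
  \<comment> \<open>The first bracket represents the image of the product of pairs, the second is
    the error; the grouping fits \<open>coset_eq_add_iff\<close>.\<close>
  have expand: "(i \<oplus>\<^bsub>A\<^esub> j) \<otimes>\<^bsub>A\<^esub> (i' \<oplus>\<^bsub>A\<^esub> j') =
      (i \<otimes>\<^bsub>A\<^esub> i' \<oplus>\<^bsub>A\<^esub> j \<otimes>\<^bsub>A\<^esub> j') \<oplus>\<^bsub>A\<^esub> (i \<otimes>\<^bsub>A\<^esub> j' \<oplus>\<^bsub>A\<^esub> j \<otimes>\<^bsub>A\<^esub> i')"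
    if "i \<in> I" "j \<in> J" "i' \<in> I" "j' \<in> J" for i j i' j'
    using that IA JA by (simp add: mult_add_left mult_add_right mult_closed M.a_ac)
  have "huq_admissible R A I J K \<longleftrightarrow>
      (\<forall>i\<in>I. \<forall>j\<in>J. \<forall>i'\<in>I. \<forall>j'\<in>J. K +>\<^bsub>A\<^esub> (i \<otimes>\<^bsub>A\<^esub> i' \<oplus>\<^bsub>A\<^esub> j \<otimes>\<^bsub>A\<^esub> j') =
        K +>\<^bsub>A\<^esub> ((i \<oplus>\<^bsub>A\<^esub> j) \<otimes>\<^bsub>A\<^esub> (i' \<oplus>\<^bsub>A\<^esub> j')))"
    using K by (simp add: huq_admissible_def prelie_hom_def Pi_iff maps
        add smult algebra_quot_mult[OF K] IA JA)
  also have "\<dots> \<longleftrightarrow>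
      (\<forall>i\<in>I. \<forall>j\<in>J. \<forall>i'\<in>I. \<forall>j'\<in>J. i \<otimes>\<^bsub>A\<^esub> j' \<oplus>\<^bsub>A\<^esub> j \<otimes>\<^bsub>A\<^esub> i' \<in> K)"
    using IA JA by (simp add: expand coset_eq_add_iff[OF K] mult_closed)
  also have "\<dots> \<longleftrightarrow> (\<forall>i\<in>I. \<forall>j\<in>J. i \<otimes>\<^bsub>A\<^esub> j \<in> K \<and> j \<otimes>\<^bsub>A\<^esub> i \<in> K)"
  proof
    assume *: "\<forall>i\<in>I. \<forall>j\<in>J. \<forall>i'\<in>I. \<forall>j'\<in>J. i \<otimes>\<^bsub>A\<^esub> j' \<oplus>\<^bsub>A\<^esub> j \<otimes>\<^bsub>A\<^esub> i' \<in> K"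
    show "\<forall>i\<in>I. \<forall>j\<in>J. i \<otimes>\<^bsub>A\<^esub> j \<in> K \<and> j \<otimes>\<^bsub>A\<^esub> i \<in> K"
    proof (intro ballI conjI)
      fix i j assume ij: "i \<in> I" "j \<in> J"
      show "i \<otimes>\<^bsub>A\<^esub> j \<in> K"
        \<comment> \<open>The other cross term becomes zero times zero, so a condition on sums
          isolates a single product.\<close>
        using *[rule_format, of i "\<zero>\<^bsub>A\<^esub>" "\<zero>\<^bsub>A\<^esub>" j] ij IA JA
        by (simp add: mult_zero_left mult_closed)
      show "j \<otimes>\<^bsub>A\<^esub> i \<in> K"
        using *[rule_format, of "\<zero>\<^bsub>A\<^esub>" j i "\<zero>\<^bsub>A\<^esub>"] ij IA JA
        by (simp add: mult_zero_left mult_closed)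
    qed
  \<comment> \<open>Conversely, each cross term lies in \<open>K\<close>, which is closed under
    addition.\<close>
  qed auto
  finally show ?thesis using K by simp
qed

end

text \<open>The equivalence covers both existence and uniqueness: the generated ideal is a Huq
  commutator, and no other set is one.\<close>

theorem proposition10:
  fixes R :: "('k, 'r) ring_scheme"
    and A :: "('k, 'a, 'm) module_scheme"
    and I J K :: "'a set"
  assumes "cring R"
    and "prelie_algebra R A"
    and "algebra_ideal R A I"
    and "algebra_ideal R A J"
  shows "is_huq_commutator R A I J K \<longleftrightarrow>
    K = ideal_generated R A
      ({i \<otimes>\<^bsub>A\<^esub> j | i j. i \<in> I \<and> j \<in> J} \<union> {j \<otimes>\<^bsub>A\<^esub> i | i j. i \<in> I \<and> j \<in> J})"
    (is "_ \<longleftrightarrow> K = ideal_generated R A ?S")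
proof -
  interpret prelie_algebra R A by fact
  have "I \<subseteq> carrier A" "J \<subseteq> carrier A"
    using assms(3,4) submoduleE(1) by (auto simp: algebra_ideal_def)
  then have "?S \<subseteq> carrier A"
    by (auto intro!: mult_closed)
  then have ideal: "algebra_ideal R A (ideal_generated R A ?S)"
    by (rule algebra_ideal_ideal_generated)
  \<comment> \<open>The admissible sets are exactly the members of the family whose intersection is
    \<open>ideal_generated R A ?S\<close>, so minimality is immediate.\<close>
  have admissible: "huq_admissible R A I J L \<longleftrightarrow> algebra_ideal R A L \<and> ?S \<subseteq> L" for L
    unfolding huq_admissible_iff[OF assms(3,4)] by blast
  have gen: "huq_admissible R A I J (ideal_generated R A ?S)"
    unfolding admissible using ideal ideal_generated_superset by (rule conjI)
  have least: "ideal_generated R A ?S \<subseteq> L" if "huq_admissible R A I J L" for L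
    using that unfolding admissible by (elim conjE) (rule ideal_generated_least)
  show ?thesis
  proof
    assume "is_huq_commutator R A I J K"
    then have "huq_admissible R A I J K" and "K \<subseteq> ideal_generated R A ?S"
      using gen by (simp_all only: is_huq_commutator_def)
    then show "K = ideal_generated R A ?S"
      by (intro subset_antisym least)
  next
    assume "K = ideal_generated R A ?S"
    then show "is_huq_commutator R A I J K"
      unfolding is_huq_commutator_def using gen least by (simp only:) fast
  qed
qed

end
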